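(* Let $p$ be a probability density on $\mathbb{R}^d$ with denoiser $F[u,\sigma]$. Let $p^*$ be a linear tilt of $p$ by a vector $v\in\mathbb{R}^d$ together with a constant negative diagonal tilt with scaling $s\ge 0$, $$p^*(x)=\frac{p(x)\,e^{v^T x-\frac12 s\|x\|^2}}{E_p[e^{v^T x-\frac12 s\|x\|^2}]},$$ where the normalizing constant is finite. Let $X'\sim p^*$ and, for any $\sigma\in[0,1]$, define $U'=\sqrt{1-\sigma^2}\,X'+\sigma Z$ with $Z\sim N(0,I)$ independent of $X'$. Denote by $G[u,\sigma]=E[X'\mid U'=u]$ the denoiser of $p^*$. Define the location shift and the time shift $$u'=\frac{\sigma^2}{\sqrt{(1-\sigma^2+s\sigma^2)(1+s\sigma^2)}}\,v+\sqrt{\frac{1-\sigma^2}{(1-\sigma^2+s\sigma^2)(1+s\sigma^2)}}\;u,\qquad \sigma'=\sqrt{\frac{\sigma^2}{1+s\sigma^2}}.$$ Then the denoiser of $p^*$ is the denoiser of $p$ evaluated at these new values: $$G[u,\sigma]=F[u',\sigma'].$$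
   Context: All densities are with respect to Lebesgue measure on $\mathbb{R}^d$; the reference density has the form $p(x)\propto e^{-V(x)}$. $E_p[h(x)]=\int h(x)p(x)\,dx$. Denoiser: for a probability density $p$ on $\mathbb{R}^d$ and $\sigma\in[0,1]$, let $X\sim p$, let $Z\sim N(0,I)$ be independent of $X$, and let $U=\sqrt{1-\sigma^2}\,X+\sigma Z$. The denoiser of $p$ is the reverse conditional expectation $F[u,\sigma]=E[X\mid U=u]$, taken with respect to the reverse conditional density $$q(x\mid u,\sigma)\propto p(x)\,e^{\frac{\sqrt{1-\sigma^2}}{\sigma^2}u^T x-\frac{1-\sigma^2}{2\sigma^2}\|x\|^2},$$ that is, $$F[u,\sigma]=\frac{\int x\,p(x)\,e^{\frac{\sqrt{1-\sigma^2}}{\sigma^2}u^T x-\frac12\left(\frac1{\sigma^2}-1\right)\|x\|^2}dx}{\int p(x)\,e^{\frac{\sqrt{1-\sigma^2}}{\sigma^2}u^T x-\frac12\left(\frac1{\sigma^2}-1\right)\|x\|^2}dx}.$$ At $\sigma=0$ one has $U=X$ and $F[u,0]=u$. The denoiser $G$ of $p^*$ is defined in the same way with $p^*$ in place of $p$.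
   Formalization: The case σ = 1, s = 0 is excluded: there 1−σ²+sσ² = 0, so the location shift u' has a zero denominator and is undefined, and the identity would read E_{p*}[X'] = E_p[X], which is false in general. *)

theory Defs
  imports "HOL-Probability.Probability"
begin

definition probability_density :: "('a::euclidean_space \<Rightarrow> real) \<Rightarrow> bool" where
  "probability_density p \<longleftrightarrow>
     p \<in> borel_measurable borel \<and> (\<forall>x. 0 \<le> p x) \<and> prob_space (density lborel p)"

definition reverse_weight :: "('a::euclidean_space \<Rightarrow> real) \<Rightarrow> 'a \<Rightarrow> real \<Rightarrow> 'a \<Rightarrow> real" where
  "reverse_weight p u \<sigma> x =
     p x * exp (sqrt (1 - \<sigma>\<^sup>2) / \<sigma>\<^sup>2 * (u \<bullet> x) - (1 - \<sigma>\<^sup>2) / (2 * \<sigma>\<^sup>2) * (norm x)\<^sup>2)"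

definition reverse_density :: "('a::euclidean_space \<Rightarrow> real) \<Rightarrow> 'a \<Rightarrow> real \<Rightarrow> 'a \<Rightarrow> real" where
  "reverse_density p u \<sigma> x = reverse_weight p u \<sigma> x / (\<integral>y. reverse_weight p u \<sigma> y \<partial>lborel)"

text \<open>
  The formula for the reverse density makes no sense at noise level 0, where the observation
  is the signal itself, so that case is separate.
\<close>

definition denoiser :: "('a::euclidean_space \<Rightarrow> real) \<Rightarrow> 'a \<Rightarrow> real \<Rightarrow> 'a" where
  "denoiser p u \<sigma> =
     (if \<sigma> = 0 then u else (\<integral>x. reverse_density p u \<sigma> x *\<^sub>R x \<partial>lborel))"

definition tilt_factor :: "'a::euclidean_space \<Rightarrow> real \<Rightarrow> 'a \<Rightarrow> real" where
  "tilt_factor v s x = exp (v \<bullet> x - s / 2 * (norm x)\<^sup>2)"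

definition tilt :: "('a::euclidean_space \<Rightarrow> real) \<Rightarrow> 'a \<Rightarrow> real \<Rightarrow> 'a \<Rightarrow> real" where
  "tilt p v s x = p x * tilt_factor v s x / (\<integral>y. tilt_factor v s y \<partial>density lborel p)"

definition location_shift :: "real \<Rightarrow> 'a::euclidean_space \<Rightarrow> real \<Rightarrow> 'a \<Rightarrow> 'a" where
  "location_shift s v \<sigma> u =
     (\<sigma>\<^sup>2 / sqrt ((1 - \<sigma>\<^sup>2 + s * \<sigma>\<^sup>2) * (1 + s * \<sigma>\<^sup>2))) *\<^sub>R v +
     sqrt ((1 - \<sigma>\<^sup>2) / ((1 - \<sigma>\<^sup>2 + s * \<sigma>\<^sup>2) * (1 + s * \<sigma>\<^sup>2))) *\<^sub>R u"

definition time_shift :: "real \<Rightarrow> real \<Rightarrow> real" where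
  "time_shift s \<sigma> = sqrt (\<sigma>\<^sup>2 / (1 + s * \<sigma>\<^sup>2))"

lemma probability_density_tilt:
  fixes p :: "'a::euclidean_space \<Rightarrow> real"
  assumes "probability_density p" and int: "integrable (density lborel p) (tilt_factor v s)"
  shows "probability_density (tilt p v s)"
proof -
  have p [measurable]: "p \<in> borel_measurable borel" and p0: "\<And>x. 0 \<le> p x"
    and "prob_space (density lborel p)"
    using assms by (auto simp: probability_density_def)
  then interpret prob_space "density lborel p" by simp
  have m [measurable]: "tilt_factor v s \<in> borel_measurable borel"
    unfolding tilt_factor_def by measurable
  have t0: "0 < tilt_factor v s x" for x by (simp add: tilt_factor_def)
  define C where "C = (\<integral>y. tilt_factor v s y \<partial>density lborel p)"
  have "C \<noteq> 0"
    unfolding C_def using integral_nonneg_eq_0_iff_AE[OF int] unfolding tilt_factor_def by simp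
  moreover have "C \<ge> 0" unfolding C_def by (simp add: less_imp_le[OF t0])
  ultimately have C: "C > 0" by simp
  have pt: "integrable lborel (\<lambda>x. p x * tilt_factor v s x)"
    using int p0 by (simp add: integrable_density)
  have "(\<integral>x. p x * tilt_factor v s x \<partial>lborel) = C"
    unfolding C_def using p0 by (simp add: integral_density)
  then have t1: "(\<integral>x. tilt p v s x \<partial>lborel) = 1"
    using C by (simp add: tilt_def flip: C_def)
  have ti: "integrable lborel (tilt p v s)"
    unfolding tilt_def by (intro integrable_divide_zero pt)
  have nn: "0 \<le> tilt p v s x" for x
    using p0 C by (simp add: tilt_def less_imp_le[OF t0] flip: C_def)
  have tm: "tilt p v s \<in> borel_measurable borel"
    unfolding tilt_def by measurable
  have "(\<integral>\<^sup>+ x. ennreal (tilt p v s x) \<partial>lborel) = 1"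
    by (subst nn_integral_eq_integral[OF ti]) (simp_all add: nn t1)
  then have "prob_space (density lborel (tilt p v s))"
    using tm by (intro prob_spaceI) (simp add: emeasure_density)
  with tm nn show ?thesis
    by (simp add: probability_density_def)
qed

definition std_gaussian_density :: "'a::euclidean_space \<Rightarrow> real" where
  "std_gaussian_density z = exp (- (norm z)\<^sup>2 / 2) / sqrt (2 * pi) ^ DIM('a)"

lemma std_gaussian_density_pos: "0 < std_gaussian_density z"
  by (simp add: std_gaussian_density_def)

lemma borel_measurable_std_gaussian_density [measurable]:
  "std_gaussian_density \<in> borel_measurable borel"
  unfolding std_gaussian_density_def by measurable

lemma borel_measurable_denoiser [measurable]:
  fixes p :: "'a::euclidean_space \<Rightarrow> real"
  assumes [measurable]: "p \<in> borel_measurable borel"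
  shows "(\<lambda>u. denoiser p u \<sigma>) \<in> borel_measurable borel"
proof (cases "\<sigma> = 0")
  case False
  have m: "(\<lambda>(u, x). reverse_weight p u \<sigma> x) \<in> borel_measurable (borel \<Otimes>\<^sub>M lborel)"
    unfolding reverse_weight_def by measurable
  have [measurable]: "(\<lambda>u. \<integral>y. reverse_weight p u \<sigma> y \<partial>lborel) \<in> borel_measurable borel"
    by (rule lborel.borel_measurable_lebesgue_integral[OF m])
  have "(\<lambda>(u, x). reverse_density p u \<sigma> x *\<^sub>R x) \<in> borel_measurable (borel \<Otimes>\<^sub>M lborel)"
    unfolding reverse_density_def reverse_weight_def[of p _ \<sigma>, abs_def]
    using m unfolding reverse_density_def by measurable
  from lborel.borel_measurable_lebesgue_integral[OF this] False
  show ?thesis by (simp add: denoiser_def)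
qed (simp add: denoiser_def)

lemma gaussian_likelihood:
  fixes p :: "'a::euclidean_space \<Rightarrow> real"
  assumes "0 < \<sigma>" "\<sigma> \<le> 1"
  shows "p x * std_gaussian_density ((1 / \<sigma>) *\<^sub>R (u - sqrt (1 - \<sigma>\<^sup>2) *\<^sub>R x)) =
           std_gaussian_density ((1 / \<sigma>) *\<^sub>R u) * reverse_weight p u \<sigma> x"
proof -
  define a where "a = sqrt (1 - \<sigma>\<^sup>2)"
  have a2: "1 - \<sigma>\<^sup>2 = a\<^sup>2" using assms by (simp add: a_def power_le_one)
  have n: "(norm (u - a *\<^sub>R x))\<^sup>2 = (norm u)\<^sup>2 - 2 * a * (u \<bullet> x) + a\<^sup>2 * (norm x)\<^sup>2"
    by (simp add: power2_norm_eq_inner inner_diff inner_commute) (simp add: power2_eq_square algebra_simps)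
  have "- (norm ((1 / \<sigma>) *\<^sub>R (u - a *\<^sub>R x)))\<^sup>2 / 2 =
    - (norm ((1 / \<sigma>) *\<^sub>R u))\<^sup>2 / 2 + (a / \<sigma>\<^sup>2 * (u \<bullet> x) - a\<^sup>2 / (2 * \<sigma>\<^sup>2) * (norm x)\<^sup>2)"
    using assms by (simp add: power_divide n) (simp add: field_simps)
  note e = this
  show ?thesis
    unfolding std_gaussian_density_def reverse_weight_def a_def[symmetric]
    unfolding e a2 exp_add by simp
qed

lemma reverse_weight_scaleR_integrable:
  fixes p :: "'a::euclidean_space \<Rightarrow> real" and h :: "'a \<Rightarrow> 'b::euclidean_space"
  assumes s: "0 < \<sigma>" "\<sigma> \<le> 1" and [measurable]: "p \<in> borel_measurable borel"
    and i: "integrable lborel (\<lambda>x. p x *\<^sub>R h x)" 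
  shows "integrable lborel (\<lambda>x. reverse_weight p u \<sigma> x *\<^sub>R h x)"
proof -
  have b: "reverse_weight (\<lambda>_. 1) u \<sigma> x \<le> 1 / exp (- (norm ((1 / \<sigma>) *\<^sub>R u))\<^sup>2 / 2)" for x
  proof -
    have "exp (- (norm ((1 / \<sigma>) *\<^sub>R u))\<^sup>2 / 2) * reverse_weight (\<lambda>_. 1) u \<sigma> x \<le> 1"
      using gaussian_likelihood[OF s, of "\<lambda>_. 1" x u, symmetric]
      unfolding std_gaussian_density_def by simp
    then show ?thesis by (simp add: pos_le_divide_eq mult.commute)
  qed
  have "integrable lborel (\<lambda>x. reverse_weight (\<lambda>_. 1) u \<sigma> x *\<^sub>R (p x *\<^sub>R h x))"
  proof (rule Bochner_Integration.integrable_bound)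
    show "integrable lborel (\<lambda>x. (1 / exp (- (norm ((1 / \<sigma>) *\<^sub>R u))\<^sup>2 / 2)) *\<^sub>R (p x *\<^sub>R h x))"
      using i by (rule integrable_scaleR_right)
    show "(\<lambda>x. reverse_weight (\<lambda>_. 1) u \<sigma> x *\<^sub>R (p x *\<^sub>R h x)) \<in> borel_measurable lborel"
      using borel_measurable_integrable[OF i] unfolding reverse_weight_def by measurable
    have "0 \<le> reverse_weight (\<lambda>_. 1) u \<sigma> x" for x by (simp add: reverse_weight_def)
    then show "AE x in lborel. norm (reverse_weight (\<lambda>_. 1) u \<sigma> x *\<^sub>R (p x *\<^sub>R h x)) \<le> norm ((1 / exp (- (norm ((1 / \<sigma>) *\<^sub>R u))\<^sup>2 / 2)) *\<^sub>R (p x *\<^sub>R h x))"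
      using b by (intro AE_I2) (simp only: norm_scaleR, intro mult_right_mono, auto simp: abs_of_nonneg)
  qed
  then show ?thesis by (simp add: reverse_weight_def mult_ac)
qed

text \<open>
  At every noise level, \<^const>\<open>denoiser\<close> is a version of the conditional expectation of the signal
  given the noisy observation. The statement is componentwise because \<^const>\<open>real_cond_exp\<close>
  is real-valued.
\<close>

lemma (in prob_space) denoiser_eq_cond_exp:
  fixes X Z :: "'a \<Rightarrow> 'b::euclidean_space" and p :: "'b \<Rightarrow> real"
  assumes \<sigma>: "0 \<le> \<sigma>" "\<sigma> \<le> 1"
    and p: "\<And>x. 0 \<le> p x"
    and X: "distributed M lborel X p"
    and Z: "distributed M lborel Z std_gaussian_density"
    and indep: "indep_var lborel X lborel Z"
    and int: "integrable M X"
  defines "U \<equiv> \<lambda>\<omega>. sqrt (1 - \<sigma>\<^sup>2) *\<^sub>R X \<omega> + \<sigma> *\<^sub>R Z \<omega>"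
  shows "AE \<omega> in M. real_cond_exp M (vimage_algebra (space M) U borel) (\<lambda>\<omega>. X \<omega> \<bullet> b) \<omega> =
           denoiser p (U \<omega>) \<sigma> \<bullet> b"
proof -
  have [measurable]: "X \<in> borel_measurable M" "Z \<in> borel_measurable M"
    using distributed_measurable[OF X] distributed_measurable[OF Z] by simp_all
  have pm [measurable]: "p \<in> borel_measurable borel"
    using distributed_real_measurable[OF _ X] p by simp
  have U [measurable]: "U \<in> borel_measurable M" unfolding U_def by measurable
  let ?F = "vimage_algebra (space M) U borel"
  have sub: "subalgebra M ?F"
    unfolding subalgebra_def using sets_vimage_algebra2[of U "space M" borel] U
    by (auto simp: measurable_def)
  interpret F: finite_measure_subalgebra M ?F
    by unfold_locales (rule sub)
  have UF [measurable]: "U \<in> measurable ?F borel"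
    by (rule measurable_vimage_algebra1) simp
  have dF: "(\<lambda>\<omega>. denoiser p (U \<omega>) \<sigma> \<bullet> b) \<in> borel_measurable ?F" by measurable
  have fint: "integrable M (\<lambda>\<omega>. X \<omega> \<bullet> b)" using int by simp
  show ?thesis
  proof (cases "\<sigma> = 0")
    case True
    then have "U = X" by (simp add: U_def)
    then show ?thesis using F.real_cond_exp_F_meas[OF fint] UF True by (simp add: denoiser_def)
  next
    case False
    then have s: "0 < \<sigma>" using \<sigma> by simp
    define a where "a = sqrt (1 - \<sigma>\<^sup>2)"
    define k where "k = (\<lambda>(x, u). p x * std_gaussian_density ((1 / \<sigma>) *\<^sub>R (u - a *\<^sub>R x)) / \<sigma> ^ DIM('b))"
    have k0: "0 \<le> k xu" for xu
      using p s by (auto simp: k_def std_gaussian_density_pos[THEN less_imp_le] split: prod.split)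
    have [measurable]: "k \<in> borel_measurable (borel \<Otimes>\<^sub>M borel)"
      unfolding k_def by measurable
    have XZ: "distributed M (lborel \<Otimes>\<^sub>M lborel) (\<lambda>\<omega>. (X \<omega>, Z \<omega>))
        (\<lambda>(x, z). ennreal (p x) * ennreal (std_gaussian_density z))"
      by (rule distributed_joint_indep[OF _ _ X Z indep]) (rule sigma_finite_lborel)+
    have XU: "distributed M (lborel \<Otimes>\<^sub>M lborel) (\<lambda>\<omega>. (X \<omega>, U \<omega>)) k"
      unfolding distributed_def
    proof (intro conjI measure_eqI)
      fix A assume "A \<in> sets (distr M (lborel \<Otimes>\<^sub>M lborel) (\<lambda>\<omega>. (X \<omega>, U \<omega>)))"
      then have A [measurable]: "A \<in> sets (borel \<Otimes>\<^sub>M borel :: ('b \<times> 'b) measure)"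
        by (simp cong: sets_pair_measure_cong)
      have "emeasure (distr M (lborel \<Otimes>\<^sub>M lborel) (\<lambda>\<omega>. (X \<omega>, U \<omega>))) A =
          (\<integral>\<^sup>+ \<omega>. indicator A (X \<omega>, a *\<^sub>R X \<omega> + \<sigma> *\<^sub>R Z \<omega>) \<partial>M)"
        unfolding U_def a_def[symmetric]
        by (subst nn_integral_indicator[symmetric], simp cong: sets_pair_measure_cong)
           (subst nn_integral_distr, auto cong: measurable_cong_sets sets_pair_measure_cong)
      also have "\<dots> = (\<integral>\<^sup>+ xz. (case xz of (x, z) \<Rightarrow> ennreal (p x) * ennreal (std_gaussian_density z)) *
          (case xz of (x, z) \<Rightarrow> indicator A (x, a *\<^sub>R x + \<sigma> *\<^sub>R z)) \<partial>(lborel \<Otimes>\<^sub>M lborel))"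
        by (subst distributed_nn_integral[OF XZ]) auto
      also have "\<dots> = (\<integral>\<^sup>+ x. \<integral>\<^sup>+ z. ennreal (p x) * ennreal (std_gaussian_density z) *
           indicator A (x, a *\<^sub>R x + \<sigma> *\<^sub>R z) \<partial>lborel \<partial>lborel)"
        by (subst lborel.nn_integral_fst[symmetric]) auto
      also have "\<dots> = (\<integral>\<^sup>+ x. \<integral>\<^sup>+ u. ennreal (k (x, u)) * indicator A (x, u) \<partial>lborel \<partial>lborel)"
      proof (rule nn_integral_cong)
        fix x :: 'b
        have "(\<integral>\<^sup>+ u. ennreal (k (x, u)) * indicator A (x, u) \<partial>lborel) =
          (\<integral>\<^sup>+ u. ennreal (k (x, u)) * indicator A (x, u)
             \<partial>density (distr lborel borel (\<lambda>z. a *\<^sub>R x + \<sigma> *\<^sub>R z)) (\<lambda>_. ennreal (\<bar>\<sigma>\<bar> ^ DIM('b))))"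
          by (subst lborel_affine[OF False, of "a *\<^sub>R x"]) simp
        also have "\<dots> = (\<integral>\<^sup>+ z. ennreal (\<bar>\<sigma>\<bar> ^ DIM('b)) *
            (ennreal (k (x, a *\<^sub>R x + \<sigma> *\<^sub>R z)) * indicator A (x, a *\<^sub>R x + \<sigma> *\<^sub>R z)) \<partial>lborel)"
          by (subst nn_integral_density) (simp_all add: nn_integral_distr)
        also have "\<dots> = (\<integral>\<^sup>+ z. ennreal (p x) * ennreal (std_gaussian_density z) *
           indicator A (x, a *\<^sub>R x + \<sigma> *\<^sub>R z) \<partial>lborel)"
        proof (intro nn_integral_cong)
          fix z :: 'b
          have "ennreal (\<bar>\<sigma>\<bar> ^ DIM('b)) * ennreal (k (x, a *\<^sub>R x + \<sigma> *\<^sub>R z)) =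
              ennreal (\<bar>\<sigma>\<bar> ^ DIM('b) * k (x, a *\<^sub>R x + \<sigma> *\<^sub>R z))"
            using s by (simp add: ennreal_mult')
          also have "\<bar>\<sigma>\<bar> ^ DIM('b) * k (x, a *\<^sub>R x + \<sigma> *\<^sub>R z) = p x * std_gaussian_density z"
            using s by (simp add: k_def)
          also have "ennreal \<dots> = ennreal (p x) * ennreal (std_gaussian_density z)"
            using p by (simp add: ennreal_mult')
          finally show "ennreal (\<bar>\<sigma>\<bar> ^ DIM('b)) *
              (ennreal (k (x, a *\<^sub>R x + \<sigma> *\<^sub>R z)) * indicator A (x, a *\<^sub>R x + \<sigma> *\<^sub>R z)) =
            ennreal (p x) * ennreal (std_gaussian_density z) * indicator A (x, a *\<^sub>R x + \<sigma> *\<^sub>R z)"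
            by (simp flip: mult.assoc)
        qed
        finally show "(\<integral>\<^sup>+ z. ennreal (p x) * ennreal (std_gaussian_density z) *
           indicator A (x, a *\<^sub>R x + \<sigma> *\<^sub>R z) \<partial>lborel) =
           (\<integral>\<^sup>+ u. ennreal (k (x, u)) * indicator A (x, u) \<partial>lborel)" ..
      qed
      also have "\<dots> = emeasure (density (lborel \<Otimes>\<^sub>M lborel) k) A"
        by (subst emeasure_density, simp cong: measurable_cong_sets sets_pair_measure_cong, simp cong: measurable_cong_sets sets_pair_measure_cong)
          (subst lborel.nn_integral_fst[symmetric], auto)
      finally show "emeasure (distr M (lborel \<Otimes>\<^sub>M lborel) (\<lambda>\<omega>. (X \<omega>, U \<omega>))) A =
        emeasure (density (lborel \<Otimes>\<^sub>M lborel) k) A" .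
    qed auto
    define N where "N u = (\<integral>x. k (x, u) \<partial>lborel)" for u
    define c where "c u = std_gaussian_density ((1 / \<sigma>) *\<^sub>R u) / \<sigma> ^ DIM('b)" for u :: 'b
    have kw: "k (x, u) = c u * reverse_weight p u \<sigma> x" for x u
      unfolding k_def c_def using gaussian_likelihood[OF s \<sigma>(2), of p x u] by (simp add: a_def)
    have c0: "c u > 0" for u using s by (simp add: c_def std_gaussian_density_pos)
    have pint: "integrable lborel p"
      using distributed_integrable[OF X, of "\<lambda>_. 1 :: real"] p by simp
    have p1: "integral\<^sup>L lborel p = 1"
      using distributed_integral[OF X, of "\<lambda>_. 1 :: real"] p by (simp add: prob_space)
    have wint: "integrable lborel (reverse_weight p u \<sigma>)" for u
      using reverse_weight_scaleR_integrable[OF s \<sigma>(2) pm, of "\<lambda>_. 1::real"] pint by simp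
    have pxint: "integrable lborel (\<lambda>x. p x *\<^sub>R x)"
    proof -
      have "integrable (distr M lborel X) (\<lambda>x. x)"
        by (subst integrable_distr_eq) (use int in auto)
      then have "integrable (density lborel p) (\<lambda>x. x)"
        by (simp only: distributed_distr_eq_density[OF X])
      then show ?thesis
        by (subst (asm) integrable_density) (use p in auto)
    qed
    have wxint: "integrable lborel (\<lambda>x. reverse_weight p u \<sigma> x *\<^sub>R x)" for u
      by (rule reverse_weight_scaleR_integrable[OF s \<sigma>(2) pm pxint])
    have w0: "(\<integral>x. reverse_weight p u \<sigma> x \<partial>lborel) \<noteq> 0" for u
    proof
      assume "(\<integral>x. reverse_weight p u \<sigma> x \<partial>lborel) = 0"
      moreover have "AE x in lborel. 0 \<le> reverse_weight p u \<sigma> x"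
        using p by (simp add: reverse_weight_def)
      ultimately have "AE x in lborel. reverse_weight p u \<sigma> x = 0"
        using integral_nonneg_eq_0_iff_AE[OF wint] by blast
      then have "AE x in lborel. p x = 0" by (simp add: reverse_weight_def)
      then have "integral\<^sup>L lborel p = 0" by (rule integral_eq_zero_AE)
      then show False using p1 by simp
    qed
    have NF: "N u * (denoiser p u \<sigma> \<bullet> b) = (\<integral>x. k (x, u) * (x \<bullet> b) \<partial>lborel)" for u
    proof -
      have "denoiser p u \<sigma> = (1 / (\<integral>x. reverse_weight p u \<sigma> x \<partial>lborel)) *\<^sub>R
          (\<integral>x. reverse_weight p u \<sigma> x *\<^sub>R x \<partial>lborel)"
        using False by (simp add: denoiser_def reverse_density_def divide_inverse_commute flip: scaleR_scaleR integral_scaleR_right)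
      moreover have "(\<integral>x. reverse_weight p u \<sigma> x *\<^sub>R x \<partial>lborel) \<bullet> b =
          (\<integral>x. reverse_weight p u \<sigma> x * (x \<bullet> b) \<partial>lborel)"
        using wxint by (simp flip: integral_inner_left)
      ultimately show ?thesis using w0[of u] by (simp add: N_def kw mult.assoc)
    qed
    have kf: "integrable (lborel \<Otimes>\<^sub>M lborel) (\<lambda>(x, u). k (x, u) * (x \<bullet> b))"
      using distributed_integrable[OF XU, of "\<lambda>(x, u). x \<bullet> b"] k0 fint by (simp add: split_beta')
    have dist_U: "distributed M lborel U (\<lambda>u. ennreal (N u))"
    proof -
      have "(\<lambda>u. ennreal (N u)) = (\<lambda>u. \<integral>\<^sup>+x. ennreal (k (x, u)) \<partial>lborel)"
      proof
        fix u
        have "integrable lborel (\<lambda>x. k (x, u))" using wint by (simp add: kw)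
        then show "ennreal (N u) = (\<integral>\<^sup>+x. ennreal (k (x, u)) \<partial>lborel)"
          unfolding N_def by (intro nn_integral_eq_integral[symmetric] AE_I2 k0)
      qed
      then show ?thesis
        using distr_marginal2[OF sigma_finite_lborel sigma_finite_lborel XU] by simp
    qed
    have N0: "0 \<le> N u" for u by (simp add: N_def k0)
    have gint: "integrable M (\<lambda>\<omega>. denoiser p (U \<omega>) \<sigma> \<bullet> b)"
      using distributed_integrable[OF dist_U, of "\<lambda>u. denoiser p u \<sigma> \<bullet> b"] N0
        lborel_pair.integrable_snd[of "\<lambda>x u. k (x, u) * (x \<bullet> b)"] kf NF by simp
    show ?thesis
    proof (rule F.real_cond_exp_charact[OF _ fint gint dF])
      fix A assume "A \<in> sets ?F"
      then obtain B where B [measurable]: "B \<in> sets borel" and A: "A = U -` B \<inter> space M"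
        by (auto simp: sets_vimage_algebra2)
      have ind: "indicator A \<omega> = (indicator B (U \<omega>) :: real)" if "\<omega> \<in> space M" for \<omega>
        using that by (simp add: A indicator_def)
      have kB: "integrable (lborel \<Otimes>\<^sub>M lborel) (\<lambda>(x, u). k (x, u) * (indicator B u * (x \<bullet> b)))"
        by (rule Bochner_Integration.integrable_bound[OF kf]) (auto simp: indicator_def split: if_splits)
      have "(\<integral>\<omega>\<in>A. X \<omega> \<bullet> b \<partial>M) = (\<integral>\<omega>. indicator B (U \<omega>) * (X \<omega> \<bullet> b) \<partial>M)"
        unfolding set_lebesgue_integral_def by (intro Bochner_Integration.integral_cong) (simp_all add: ind)
      also have "\<dots> = (\<integral>xu. k xu * (case xu of (x, u) \<Rightarrow> indicator B u * (x \<bullet> b)) \<partial>(lborel \<Otimes>\<^sub>M lborel))"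
        by (subst distributed_integral[OF XU]) (auto simp: k0)
      also have "\<dots> = (\<integral>u. \<integral>x. k (x, u) * (indicator B u * (x \<bullet> b)) \<partial>lborel \<partial>lborel)"
        using lborel_pair.integral_snd[OF kB] by (simp add: split_beta')
      also have "\<dots> = (\<integral>u. N u * (indicator B u * (denoiser p u \<sigma> \<bullet> b)) \<partial>lborel)"
        by (intro Bochner_Integration.integral_cong refl) (simp add: mult.left_commute NF)
      also have "\<dots> = (\<integral>\<omega>. indicator B (U \<omega>) * (denoiser p (U \<omega>) \<sigma> \<bullet> b) \<partial>M)"
        by (rule distributed_integral[OF dist_U]) (auto simp: N0)
      also have "\<dots> = (\<integral>\<omega>\<in>A. denoiser p (U \<omega>) \<sigma> \<bullet> b \<partial>M)"
        unfolding set_lebesgue_integral_def by (intro Bochner_Integration.integral_cong) (simp_all add: ind)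
      finally show "(\<integral>\<omega>\<in>A. X \<omega> \<bullet> b \<partial>M) = (\<integral>\<omega>\<in>A. denoiser p (U \<omega>) \<sigma> \<bullet> b \<partial>M)" .
    qed
  qed
qed

end

theory Submission
  imports Defs
begin

text \<open>
  Multiplying the reverse weight of \<open>p\<close> by the tilt factor changes only the coefficients of
  \<open>x\<close> and \<open>\<parallel>x\<parallel>\<^sup>2\<close> in its Gaussian exponent. The location and time shifts are the parameters of
  the reverse weight of \<open>p\<close> that has these new coefficients, and the normalizing constant of the
  tilt cancels in the reverse density.
\<close>

text \<open>This is the squared weight of the signal at the shifted noise level; it determines both
  coefficients in the exponent of the shifted reverse weight.\<close>

lemma one_minus_time_shift_sq:
  assumes "0 < 1 + s * \<sigma>\<^sup>2"
  shows "1 - (time_shift s \<sigma>)\<^sup>2 = (1 - \<sigma>\<^sup>2 + s * \<sigma>\<^sup>2) / (1 + s * \<sigma>\<^sup>2)"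
  using assms by (simp add: time_shift_def field_simps)

lemma reverse_weight_shift:
  fixes p :: "'a::euclidean_space \<Rightarrow> real"
  assumes \<sigma>: "\<sigma> \<noteq> 0" and A: "0 < 1 - \<sigma>\<^sup>2 + s * \<sigma>\<^sup>2" and B: "0 < 1 + s * \<sigma>\<^sup>2"
  shows "reverse_weight p (location_shift s v \<sigma> u) (time_shift s \<sigma>) x =
           reverse_weight p u \<sigma> x * tilt_factor v s x"
proof -
  define t where "t = \<sigma>\<^sup>2"
  define A B where "A = 1 - t + s * t" and "B = 1 + s * t"
  have pos: "0 < A" "0 < B" "0 < t"
    using \<sigma> A B by (simp_all add: A_def B_def t_def)
  have ts: "(time_shift s \<sigma>)\<^sup>2 = t / B"
    using pos by (simp add: time_shift_def flip: B_def t_def)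
  have om: "1 - (time_shift s \<sigma>)\<^sup>2 = A / B"
    using one_minus_time_shift_sq[OF B] by (simp add: A_def B_def t_def)
  \<comment> \<open>The coefficient of the inner product with the shifted location; its factor
    \<open>sqrt (A * B)\<close> cancels the common denominator in
    \<open>location_shift\<close>.\<close>
  have coeff: "sqrt (A / B) / (t / B) = sqrt (A * B) / t"
    using pos by (simp add: real_sqrt_divide real_sqrt_mult field_simps)
  have "location_shift s v \<sigma> u =
      (t / sqrt (A * B)) *\<^sub>R v + (sqrt (1 - t) / sqrt (A * B)) *\<^sub>R u"
    by (simp only: location_shift_def A_def B_def t_def real_sqrt_divide)
  moreover have "sqrt (A * B) \<noteq> 0"
    using pos by simp
  ultimately have lin: "sqrt (A * B) / t * (location_shift s v \<sigma> u \<bullet> x) =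
      v \<bullet> x + sqrt (1 - t) / t * (u \<bullet> x)"
    using pos by (simp add: inner_add_left distrib_left del: real_sqrt_eq_zero_cancel_iff)
  \<comment> \<open>\<open>B\<close> cancels, and the summand \<open>s * t\<close> of
    \<open>A\<close> yields the quadratic part of the tilt.\<close>
  have quad: "(A / B) / (2 * (t / B)) = (1 - t) / (2 * t) + s / 2"
    using pos by (simp add: A_def field_simps flip: t_def)
  show ?thesis
    unfolding reverse_weight_def tilt_factor_def om unfolding ts coeff lin quad t_def[symmetric]
    by (simp add: algebra_simps flip: exp_add)
qed

theorem theorem2:
  fixes p :: "'a::euclidean_space \<Rightarrow> real" and u v :: 'a and s \<sigma> :: real
  assumes "probability_density p"
    and "0 \<le> s"
    and "integrable (density lborel p) (tilt_factor v s)"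
    and "0 \<le> \<sigma>" and "\<sigma> \<le> 1"
    and "1 - \<sigma>\<^sup>2 + s * \<sigma>\<^sup>2 \<noteq> 0"
  shows "denoiser (tilt p v s) u \<sigma> = denoiser p (location_shift s v \<sigma> u) (time_shift s \<sigma>)"
proof (cases "\<sigma> = 0")
  \<comment> \<open>Without noise the shift coefficients of \<open>v\<close> and \<open>u\<close>
    are 0 and 1, and both denoisers return \<open>u\<close>.\<close>
  case True
  then show ?thesis by (simp add: denoiser_def location_shift_def time_shift_def)
next
  case False
  define C where "C = (\<integral>y. tilt_factor v s y \<partial>density lborel p)"
  have "C \<noteq> 0"
  proof
    assume "C = 0"
    \<comment> \<open>Division by zero gives 0, so the tilt would have total mass 0 instead of
      1.\<close>
    then have "tilt p v s = (\<lambda>_. 0)"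
      by (simp add: fun_eq_iff tilt_def flip: C_def)
    with probability_density_tilt[OF assms(1,3)] have "prob_space (density lborel (\<lambda>_::'a. 0))"
      by (simp add: probability_density_def)
    from prob_space.emeasure_space_1[OF this] show False
      by (simp add: emeasure_density)
  qed
  have B: "0 < 1 + s * \<sigma>\<^sup>2"
    using \<open>0 \<le> s\<close> by (simp add: add_pos_nonneg)
  \<comment> \<open>A sum of two nonnegative terms; it vanishes only for \<sigma> = 1 and
    \<open>s = 0\<close>, where the location shift has denominator 0.\<close>
  have "0 \<le> 1 - \<sigma>\<^sup>2 + s * \<sigma>\<^sup>2"
    using assms by (simp add: power_le_one)
  with assms(6) have A: "0 < 1 - \<sigma>\<^sup>2 + s * \<sigma>\<^sup>2"
    by linarith
  let ?u = "location_shift s v \<sigma> u" and ?\<sigma> = "time_shift s \<sigma>"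
  have w: "reverse_weight (tilt p v s) u \<sigma> = (\<lambda>x. reverse_weight p ?u ?\<sigma> x / C)"
    unfolding reverse_weight_shift[OF False A B]
    by (simp add: fun_eq_iff reverse_weight_def tilt_def flip: C_def)
  have "reverse_density (tilt p v s) u \<sigma> = reverse_density p ?u ?\<sigma>"
    using \<open>C \<noteq> 0\<close> by (simp add: fun_eq_iff reverse_density_def w)
  \<comment> \<open>Both denoisers are thus given by the integral of the reverse density.\<close>
  moreover have "?\<sigma> \<noteq> 0"
    using False B by (simp add: time_shift_def)
  ultimately show ?thesis
    using False by (simp add: denoiser_def)
qed

end
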